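(* Suppose that $f$ is a proper closed function on $\mathbb{R}^n$ taking the form $$f(x)=l(Ax)+\min_{1\le i\le r}P_i(x),$$ where $A\in\mathbb{R}^{m\times n}$, $P_i$ are proper closed polyhedral functions for $i=1,\ldots,r$, and $l$ satisfies either one of the following two conditions: (i) $l$ is a proper closed convex function with an open domain, is strongly convex on any compact convex subset of $\mathrm{dom}\,l$ and is twice continuously differentiable on $\mathrm{dom}\,l$; (ii) $l(y)=\max_{u\in D}\{\langle y,u\rangle-q(u)\}$ for all $y\in\mathbb{R}^m$, with $D$ being a polyhedron and $q$ being a strongly convex differentiable function with a Lipschitz continuous gradient. Suppose in addition that $f$ is continuous on $\mathrm{dom}\,\partial f$. Then $f$ is a KL function with an exponent of $\frac12$.
   Context: Closed means lower semicontinuous; proper means never $-\infty$ and not identically $+\infty$; $\mathrm{dom}\,f=\{x: f(x)<\infty\}$. A polyhedral function is one whose epigraph is a (convex) polyhedron. For a proper function $f$ and $x\in\mathrm{dom}\,f$, the regular subdifferential is $\widehat\partial f(x)=\{v: \liminf_{z\to x,z\ne x}\frac{f(z)-f(x)-\langle v,z-x\rangle}{\|z-x\|}\ge 0\}$ and the (limiting) subdifferential $\partial f(x)$ is the set of $v$ for which there exist $x^t\to x$ with $f(x^t)\to f(x)$ and $v^t\to v$ with $v^t\in\widehat\partial f(x^t)$ for each $t$; $\partial f(x)=\emptyset$ if $x\notin\mathrm{dom}\,f$. $\mathrm{dom}\,\partial f=\{x:\partial f(x)\ne\emptyset\}$. "$f$ is continuous on a set $S$" means that the restriction of $f$ to $S$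 is continuous. A proper closed function $f$ has the KL property at $\bar x\in\mathrm{dom}\,\partial f$ with an exponent of $\alpha\in[0,1)$ if there exist $c,\epsilon>0$ and $\nu\in(0,\infty]$ such that $\mathrm{dist}(0,\partial f(x))\ge c\,(f(x)-f(\bar x))^\alpha$ whenever $\|x-\bar x\|\le\epsilon$ and $f(\bar x)<f(x)<f(\bar x)+\nu$ (with $\mathrm{dist}(0,\emptyset)=+\infty$). It is a KL function with an exponent of $\alpha$ if it has the KL property with exponent $\alpha$ at every $\bar x\in\mathrm{dom}\,\partial f$. *)

theory Defs
  imports "HOL-Analysis.Analysis"
begin

section \<open>Extended-real-valued functions\<close>

definition edom :: "('a \<Rightarrow> ereal) \<Rightarrow> 'a set" where
  "edom f = {x. f x < \<infinity>}"

definition proper_fun :: "('a \<Rightarrow> ereal) \<Rightarrow> bool" where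
  "proper_fun f \<longleftrightarrow> (\<forall>x. f x \<noteq> -\<infinity>) \<and> (\<exists>x. f x \<noteq> \<infinity>)"

text \<open>Closed means lower semicontinuous.\<close>
definition closed_fun :: "('a::topological_space \<Rightarrow> ereal) \<Rightarrow> bool" where
  "closed_fun f \<longleftrightarrow> (\<forall>x. f x \<le> Liminf (at x) f)"

text \<open>The library's \<^const>\<open>epigraph\<close> is restricted to real-valued functions.\<close>
definition eepigraph :: "('a \<Rightarrow> ereal) \<Rightarrow> ('a \<times> real) set" where
  "eepigraph f = {(x, t). f x \<le> ereal t}"

definition convex_fun :: "('a::real_vector \<Rightarrow> ereal) \<Rightarrow> bool" where
  "convex_fun f \<longleftrightarrow> convex (eepigraph f)"

definition polyhedral_fun :: "('a::euclidean_space \<Rightarrow> ereal) \<Rightarrow> bool" where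
  "polyhedral_fun f \<longleftrightarrow> polyhedron (eepigraph f)"

section \<open>Smoothness and strong convexity of real-valued functions\<close>

definition strongly_convex_on :: "'a::real_normed_vector set \<Rightarrow> ('a \<Rightarrow> real) \<Rightarrow> bool" where
  "strongly_convex_on S g \<longleftrightarrow> convex S \<and>
    (\<exists>\<sigma>>0. \<forall>x\<in>S. \<forall>y\<in>S. \<forall>t\<in>{0..1}.
       g (t *\<^sub>R x + (1 - t) *\<^sub>R y)
         \<le> t * g x + (1 - t) * g y - \<sigma> / 2 * t * (1 - t) * (norm (x - y))\<^sup>2)"

text \<open>Intended for open \<open>S\<close>; \<open>G\<close> is the gradient and \<open>H\<close> the Hessian operator.\<close>
definition twice_cont_diff_on :: "'a::euclidean_space set \<Rightarrow> ('a \<Rightarrow> real) \<Rightarrow> bool" where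
  "twice_cont_diff_on S g \<longleftrightarrow>
    (\<exists>(G :: 'a \<Rightarrow> 'a) (H :: 'a \<Rightarrow> 'a \<Rightarrow>\<^sub>L 'a).
       (\<forall>x\<in>S. GDERIV g x :> G x) \<and>
       (\<forall>x\<in>S. (G has_derivative blinfun_apply (H x)) (at x)) \<and>
       continuous_on S H)"

definition lipschitz_gradient :: "('a::euclidean_space \<Rightarrow> real) \<Rightarrow> bool" where
  "lipschitz_gradient g \<longleftrightarrow>
    (\<exists>G L. (\<forall>x. GDERIV g x :> G x) \<and> L-lipschitz_on UNIV G)"

section \<open>Subdifferentials\<close>

definition regular_subdiff :: "('a::euclidean_space \<Rightarrow> ereal) \<Rightarrow> 'a \<Rightarrow> 'a set" where
  "regular_subdiff f x =
    (if x \<in> edom f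
     then {v. 0 \<le> Liminf (at x) (\<lambda>z. (f z - f x - ereal (v \<bullet> (z - x))) / ereal (norm (z - x)))}
     else {})"

definition subdiff :: "('a::euclidean_space \<Rightarrow> ereal) \<Rightarrow> 'a \<Rightarrow> 'a set" where
  "subdiff f x =
    (if x \<in> edom f
     then {v. \<exists>X V. X \<longlonglongrightarrow> x \<and> (\<lambda>t. f (X t)) \<longlonglongrightarrow> f x \<and> V \<longlonglongrightarrow> v \<and>
                (\<forall>t::nat. V t \<in> regular_subdiff f (X t))}
     else {})"

definition dom_subdiff :: "('a::euclidean_space \<Rightarrow> ereal) \<Rightarrow> 'a set" where
  "dom_subdiff f = {x. subdiff f x \<noteq> {}}"

section \<open>The Kurdyka--Lojasiewicz property\<close>

text \<open>Unlike \<^const>\<open>infdist\<close>, this is \<open>\<infinity>\<close> for the empty set.\<close>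
definition edist_set :: "'a::metric_space \<Rightarrow> 'a set \<Rightarrow> ereal" where
  "edist_set x S = (INF v\<in>S. ereal (dist x v))"

text \<open>The constraints on \<open>f x\<close> make \<open>f x - f xb\<close> a positive real, so \<^const>\<open>powr\<close> is the usual power.\<close>
definition KL_property_at :: "('a::euclidean_space \<Rightarrow> ereal) \<Rightarrow> 'a \<Rightarrow> real \<Rightarrow> bool" where
  "KL_property_at f xb \<alpha> \<longleftrightarrow>
    xb \<in> dom_subdiff f \<and> 0 \<le> \<alpha> \<and> \<alpha> < 1 \<and>
    (\<exists>c \<epsilon> \<nu>. (0::real) < c \<and> (0::real) < \<epsilon> \<and> (0::ereal) < \<nu> \<and>
      (\<forall>x. norm (x - xb) \<le> \<epsilon> \<and> f xb < f x \<and> f x < f xb + \<nu> \<longrightarrow>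
         ereal (c * real_of_ereal (f x - f xb) powr \<alpha>) \<le> edist_set 0 (subdiff f x)))"

definition KL_function :: "('a::euclidean_space \<Rightarrow> ereal) \<Rightarrow> real \<Rightarrow> bool" where
  "KL_function f \<alpha> \<longleftrightarrow>
    proper_fun f \<and> closed_fun f \<and> (\<forall>xb\<in>dom_subdiff f. KL_property_at f xb \<alpha>)"

section \<open>The two conditions on the outer function\<close>

definition smooth_loss :: "('a::euclidean_space \<Rightarrow> ereal) \<Rightarrow> bool" where
  "smooth_loss l \<longleftrightarrow>
    proper_fun l \<and> closed_fun l \<and> convex_fun l \<and> open (edom l) \<and>
    (\<forall>K. compact K \<and> convex K \<and> K \<subseteq> edom l \<longrightarrow> strongly_convex_on K (\<lambda>y. real_of_ereal (l y))) \<and>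
    twice_cont_diff_on (edom l) (\<lambda>y. real_of_ereal (l y))"

text \<open>The maximum is attained; in particular \<open>D\<close> is nonempty and \<open>l\<close> is finite everywhere.\<close>
definition max_loss :: "('a::euclidean_space \<Rightarrow> ereal) \<Rightarrow> bool" where
  "max_loss l \<longleftrightarrow>
    (\<exists>(D :: 'a set) (q :: 'a \<Rightarrow> real).
       polyhedron D \<and> strongly_convex_on UNIV q \<and> lipschitz_gradient q \<and>
       (\<forall>y. \<exists>u\<in>D. l y = ereal (y \<bullet> u - q u) \<and> (\<forall>w\<in>D. y \<bullet> w - q w \<le> y \<bullet> u - q u)))"

end

theory Submission
  imports Defs
begin

text \<open>
  Write \<open>f\<close> as the minimum of the convex functions \<open>g\<^sub>i x = l (A x) + P\<^sub>i x\<close>. A regular subgradient of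
  \<open>f\<close> at \<open>x\<close> is a subgradient in the sense of convex analysis of every piece active at \<open>x\<close>
  (\<open>regular_subgradient_of_touching_minorant\<close>), so it suffices to bound the subgradients of each piece
  near a point \<open>x0\<close>; limiting subgradients follow by continuity of the inequality
  (\<open>slope_bound_min_transfer\<close>). Let \<open>a = f x0\<close>. A piece with \<open>g\<^sub>i x0 > a\<close> is not active at values near
  \<open>a\<close> close to \<open>x0\<close>, and a piece not minimized at \<open>x0\<close> has subgradients bounded away from zero.

  There remains a piece \<open>g\<^sub>i\<close> minimized at \<open>x0\<close> (\<open>slope_bound_at_minimizer\<close>). There the exponent \<open>1/2\<close>
  comes from quadratic growth: if every \<open>x\<close> near \<open>x0\<close> has a minimizer within distance of order
  \<open>\<surd>(g\<^sub>i x - a)\<close>, then the subgradient inequality gives \<open>g\<^sub>i x - a \<le> \<parallel>v\<parallel> O(\<surd>(g\<^sub>i x - a))\<close>.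
  Quadratic growth holds because the minimizers of \<open>g\<^sub>i\<close> form a polyhedron and \<open>g\<^sub>i\<close> grows at least
  quadratically with the violation of its defining inequalities, while Hoffman's error bound
  (\<open>Hoffman_error_bound\<close>) compares violation with distance. For a loss that is strongly convex near
  \<open>A x0\<close> the inequalities fix the value of \<open>A x\<close>. For a max-type loss the inequalities say that
  \<open>A x\<close> has the same maximizer in \<open>D\<close> as \<open>A x0\<close>; this is a polyhedral condition because \<open>D\<close> is a
  polyhedron, and growth transverse to it comes from the Lipschitz gradient of \<open>q\<close>
  (\<open>max_loss_polyhedral_growth\<close>).
\<close>

section \<open>Hoffman's error bound\<close>

definition halfspaces :: "('a::real_inner \<times> real) set \<Rightarrow> 'a set" where
  "halfspaces C = {x. \<forall>c\<in>C. fst c \<bullet> x \<le> snd c}"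

definition violation :: "('a::real_inner \<times> real) set \<Rightarrow> 'a \<Rightarrow> real" where
  "violation C x = (\<Sum>c\<in>C. max 0 (fst c \<bullet> x - snd c))"

lemma violation_nonneg: "0 \<le> violation C x"
  unfolding violation_def by (intro sum_nonneg) auto

lemma violation_ge_member:
  assumes "finite C" "c \<in> C"
  shows "max 0 (fst c \<bullet> x - snd c) \<le> violation C x"
  unfolding violation_def by (rule member_le_sum[OF assms(2) _ assms(1)]) auto

lemma violation_le:
  assumes "\<And>c. c \<in> C \<Longrightarrow> fst c \<bullet> x - snd c \<le> B" "0 \<le> B"
  shows "violation C x \<le> real (card C) * B"
  unfolding violation_def using assms by (intro sum_bounded_above) auto

lemma violation_eq_0_imp:
  assumes "finite C" "violation C x = 0"
  shows "x \<in> halfspaces C"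
  unfolding halfspaces_def using violation_ge_member[OF assms(1), of _ x] assms(2) by fastforce

lemma polyhedron_as_halfspaces:
  fixes S :: "'a::euclidean_space set"
  assumes "polyhedron S"
  obtains C where "finite C" "S = halfspaces C"
proof -
  obtain F where F: "finite F" "S = \<Inter> F"
    and ab: "\<forall>h\<in>F. \<exists>a b. a \<noteq> 0 \<and> h = {x. a \<bullet> x \<le> b}"
    using assms unfolding polyhedron_def by blast
  from ab have "\<forall>h\<in>F. \<exists>c. h = {x. fst c \<bullet> x \<le> snd c}"
    by (metis fst_conv snd_conv)
  then obtain c where c: "\<And>h. h \<in> F \<Longrightarrow> h = {x. fst (c h) \<bullet> x \<le> snd (c h)}"
    by metis
  have "S = halfspaces (c ` F)"
    unfolding F(2) halfspaces_def using c by blast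
  then show thesis using that F(1) by blast
qed

lemma closed_convex_halfspaces:
  fixes C :: "('a::euclidean_space \<times> real) set"
  shows "closed (halfspaces C) \<and> convex (halfspaces C)"
proof -
  have "halfspaces C = (\<Inter>c\<in>C. {x. fst c \<bullet> x \<le> snd c})"
    unfolding halfspaces_def by auto
  then show ?thesis
    by (auto intro!: closed_INT convex_INT closed_halfspace_le convex_halfspace_le)
qed

text \<open>A nonzero vector of the polar cone of \<open>K = {h. \<forall>a\<in>N. fst a \<bullet> h \<le> 0}\<close> cannot lie in \<open>K\<close>
  itself, so it violates one of the inequalities defining \<open>K\<close>. On the compact set of unit vectors
  of the polar cone the total violation therefore has a positive minimum, and homogeneity does
  the rest.\<close>
lemma polar_cone_error_bound:
  fixes N :: "('a::euclidean_space \<times> real) set"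
  assumes "finite N"
  obtains c where "c > 0"
    "\<And>d. (\<And>h. (\<forall>a\<in>N. fst a \<bullet> h \<le> 0) \<Longrightarrow> d \<bullet> h \<le> 0)
       \<Longrightarrow> c * norm d \<le> (\<Sum>a\<in>N. max 0 (fst a \<bullet> d))"
proof -
  define K where "K = {h. \<forall>a\<in>N. fst a \<bullet> h \<le> 0}"
  define U where "U = (\<Inter>h\<in>K. {d. d \<bullet> h \<le> 0}) \<inter> sphere 0 1"
  define g where "g d = (\<Sum>a\<in>N. max 0 (fst a \<bullet> d))" for d
  have compU: "compact U"
    unfolding U_def
    by (intro closed_Int_compact compact_sphere closed_INT ballI closed_Collect_le continuous_intros)
  have contg: "continuous_on U g"
    unfolding g_def by (intro continuous_intros)
  obtain c where c: "c > 0" "\<And>d. d \<in> U \<Longrightarrow> c \<le> g d"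
  proof (cases "U = {}")
    case True
    then show thesis using that[of 1] by auto
  next
    case False
    then obtain d0 where d0: "d0 \<in> U" "\<And>d. d \<in> U \<Longrightarrow> g d0 \<le> g d"
      using continuous_attains_inf[OF compU _ contg] by blast
    have "g d0 > 0"
    proof (rule ccontr)
      assume "\<not> g d0 > 0"
      then have "g d0 = 0" unfolding g_def by (simp add: antisym not_less sum_nonneg)
      then have "\<forall>a\<in>N. max 0 (fst a \<bullet> d0) = 0"
        unfolding g_def using assms by (subst (asm) sum_nonneg_eq_0_iff) auto
      then have "d0 \<in> K" unfolding K_def by (auto simp: max_def split: if_splits)
      then have "d0 \<bullet> d0 \<le> 0" using d0(1) unfolding U_def by auto
      then have "d0 = 0" by (metis inner_gt_zero_iff not_less)
      then show False using d0(1) unfolding U_def by simp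
    qed
    then show thesis using that d0(2) by blast
  qed
  show thesis
  proof (rule that[OF c(1)])
    fix d assume d: "\<And>h. (\<forall>a\<in>N. fst a \<bullet> h \<le> 0) \<Longrightarrow> d \<bullet> h \<le> 0"
    show "c * norm d \<le> (\<Sum>a\<in>N. max 0 (fst a \<bullet> d))"
    proof (cases "d = 0")
      case True
      then show ?thesis by (simp add: sum_nonneg)
    next
      case False
      define u where "u = d /\<^sub>R norm d"
      have "u \<in> U" unfolding U_def u_def K_def using d False
        by (auto simp: divide_le_0_iff mult_le_0_iff)
      then have "c \<le> g u" by (rule c(2))
      moreover have "norm d * g u = (\<Sum>a\<in>N. max 0 (fst a \<bullet> d))"
        unfolding g_def sum_distrib_left
      proof (rule sum.cong[OF refl])
        fix a assume "a \<in> N"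
        have "fst a \<bullet> d = norm d * (fst a \<bullet> u)" unfolding u_def using False by simp
        then show "norm d * max 0 (fst a \<bullet> u) = max 0 (fst a \<bullet> d)"
          by (simp add: max_mult_distrib_left)
      qed
      ultimately show ?thesis
        by (metis mult.commute mult_left_mono norm_ge_zero)
    qed
  qed
qed

text \<open>Let \<open>p\<close> be the projection of \<open>x\<close> and \<open>N\<close> the set of constraints active at \<open>p\<close>. Near \<open>p\<close> only
  the constraints in \<open>N\<close> matter, so \<open>x - p\<close> lies in the polar of their cone, and the violation of
  an active constraint at \<open>x\<close> is its value on \<open>x - p\<close>. The constant of the preceding lemma depends
  on \<open>N\<close> alone; there are finitely many subsets \<open>N\<close>, so one constant serves for all \<open>x\<close>.\<close>
lemma Hoffman_error_bound:
  fixes C :: "('a::euclidean_space \<times> real) set"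
  assumes "finite C" "halfspaces C \<noteq> {}"
  obtains \<kappa> where "\<kappa> > 0"
    "\<And>x. \<exists>p\<in>halfspaces C. norm (x - p) \<le> \<kappa> * violation C x"
proof -
  have "\<forall>N\<in>Pow C. \<exists>c>0. \<forall>d. (\<forall>h. (\<forall>a\<in>N. fst a \<bullet> h \<le> 0) \<longrightarrow> d \<bullet> h \<le> 0)
       \<longrightarrow> c * norm d \<le> (\<Sum>a\<in>N. max 0 (fst a \<bullet> d))"
  proof
    fix N assume "N \<in> Pow C"
    then have "finite N" using assms(1) finite_subset by auto
    then show "\<exists>c>0. \<forall>d. (\<forall>h. (\<forall>a\<in>N. fst a \<bullet> h \<le> 0) \<longrightarrow> d \<bullet> h \<le> 0)
       \<longrightarrow> c * norm d \<le> (\<Sum>a\<in>N. max 0 (fst a \<bullet> d))"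
      using polar_cone_error_bound by metis
  qed
  then obtain c where c: "\<And>N. N \<in> Pow C \<Longrightarrow> c N > 0"
    "\<And>N d. N \<in> Pow C \<Longrightarrow> (\<And>h. (\<forall>a\<in>N. fst a \<bullet> h \<le> 0) \<Longrightarrow> d \<bullet> h \<le> 0)
       \<Longrightarrow> c N * norm d \<le> (\<Sum>a\<in>N. max 0 (fst a \<bullet> d))"
    by metis
  define m where "m = Min (c ` Pow C)"
  have "finite (c ` Pow C)" "c ` Pow C \<noteq> {}"
    using assms(1) by auto
  then have m0: "m > 0" and mle: "\<And>N. N \<in> Pow C \<Longrightarrow> m \<le> c N"
    unfolding m_def using c(1) by (simp_all add: Min_gr_iff)
  have cl: "closed (halfspaces C)" and cv: "convex (halfspaces C)"
    using closed_convex_halfspaces by auto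
  have "norm (x - closest_point (halfspaces C) x) \<le> 1 / m * violation C x" for x
  proof -
    define p where "p = closest_point (halfspaces C) x"
    have p: "p \<in> halfspaces C"
      unfolding p_def using closest_point_in_set[OF cl assms(2)] .
    define N where "N = {a \<in> C. fst a \<bullet> p = snd a}"
    have NP: "N \<in> Pow C" unfolding N_def by auto
    have "(x - p) \<bullet> h \<le> 0" if h: "\<forall>a\<in>N. fst a \<bullet> h \<le> 0" for h
    proof -
      \<comment> \<open>Inactive constraints stay satisfied along a short step in the direction \<open>h\<close>.\<close>
      have "\<forall>a\<in>C. \<forall>\<^sub>F t in at_right 0. fst a \<bullet> (p + t *\<^sub>R h) \<le> snd a"
      proof
        fix a assume a: "a \<in> C"
        show "\<forall>\<^sub>F t in at_right 0. fst a \<bullet> (p + t *\<^sub>R h) \<le> snd a"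
        proof (cases "a \<in> N")
          case True
          then have "fst a \<bullet> h \<le> 0" "fst a \<bullet> p = snd a" using h unfolding N_def by auto
          then show ?thesis
            by (auto simp: eventually_at_right_field inner_add_right mult_le_0_iff
                intro!: exI[of _ 1])
        next
          case False
          then have "fst a \<bullet> (p + 0 *\<^sub>R h) < snd a"
            using a p unfolding N_def halfspaces_def by force
          moreover have "((\<lambda>t. fst a \<bullet> (p + t *\<^sub>R h)) \<longlongrightarrow> fst a \<bullet> (p + 0 *\<^sub>R h)) (at_right 0)"
            by (intro tendsto_intros)
          ultimately have "\<forall>\<^sub>F t in at_right 0. fst a \<bullet> (p + t *\<^sub>R h) < snd a"
            by (metis order_tendstoD(2))
          then show ?thesis by (rule eventually_mono) auto
        qed
      qed
      then have "\<forall>\<^sub>F t in at_right 0. \<forall>a\<in>C. fst a \<bullet> (p + t *\<^sub>R h) \<le> snd a"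
        using assms(1) by (simp add: eventually_ball_finite_distrib)
      then have "\<forall>\<^sub>F t in at_right 0. 0 < t \<and> p + t *\<^sub>R h \<in> halfspaces C"
        unfolding halfspaces_def using eventually_at_right_less[of "0::real"]
        by (simp add: eventually_conj_iff)
      from eventually_happens'[OF _ this]
      obtain t :: real where t: "t > 0" "p + t *\<^sub>R h \<in> halfspaces C"
        by auto
      have "(x - p) \<bullet> (p + t *\<^sub>R h - p) \<le> 0"
        unfolding p_def by (rule closest_point_dot[OF cv cl]) (use t in \<open>simp add: p_def\<close>)
      then show ?thesis using t(1) by (simp add: mult_le_0_iff)
    qed
    then have "c N * norm (x - p) \<le> (\<Sum>a\<in>N. max 0 (fst a \<bullet> (x - p)))"
      using c(2)[OF NP] by blast
    also have "\<dots> = (\<Sum>a\<in>N. max 0 (fst a \<bullet> x - snd a))"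
      by (rule sum.cong) (auto simp: N_def inner_diff_right)
    also have "\<dots> \<le> violation C x"
      unfolding violation_def using assms(1) by (intro sum_mono2) (auto simp: N_def)
    finally have "m * norm (x - p) \<le> violation C x"
      using mult_right_mono[OF mle[OF NP] norm_ge_zero] by (rule order_trans[rotated])
    then show ?thesis using m0 by (simp add: p_def field_simps)
  qed
  then show thesis
    using that[of "1 / m"] m0 closest_point_in_set[OF cl assms(2)] by (meson zero_less_divide_1_iff)
qed

section \<open>Quadratic growth of the loss, up to a polyhedron\<close>

lemma directional_derivative_from_gradient:
  assumes "GDERIV g x :> w"
  shows "((\<lambda>t. (g (x + t *\<^sub>R d) - g x) / t) \<longlongrightarrow> w \<bullet> d) (at_right (0::real))"
proof -
  have "((\<lambda>t::real. x + t *\<^sub>R d) has_derivative (\<lambda>t. t *\<^sub>R d)) (at 0)"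
    by (auto intro!: derivative_eq_intros)
  moreover have "(g has_derivative (\<lambda>h. h \<bullet> w)) (at (x + 0 *\<^sub>R d))"
    using assms by (simp add: gderiv_def)
  ultimately have "((\<lambda>t::real. g (x + t *\<^sub>R d)) has_derivative (\<lambda>t. (t *\<^sub>R d) \<bullet> w)) (at 0)"
    by (rule has_derivative_compose)
  then have "((\<lambda>t::real. g (x + t *\<^sub>R d)) has_field_derivative (w \<bullet> d)) (at 0)"
    by (simp add: has_field_derivative_def inner_commute mult.commute[of "w \<bullet> d"] mult_commute_abs)
  then show ?thesis
    unfolding has_field_derivative_iff by (auto intro: filterlim_at_within_not_equal tendsto_within_subset)
qed

text \<open>Divide the strong convexity inequality by \<open>t\<close> and let \<open>t\<close> tend to \<open>0\<close>. It is stated for a single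
  pair of points because strong convexity may hold only on a set.\<close>
lemma strongly_convex_gradient_growth:
  assumes sc: "\<And>t. t \<in> {0..1} \<Longrightarrow> g (t *\<^sub>R y + (1 - t) *\<^sub>R x)
      \<le> t * g y + (1 - t) * g x - \<sigma> / 2 * t * (1 - t) * (norm (y - x))\<^sup>2"
    and w: "GDERIV g x :> w"
  shows "g x + w \<bullet> (y - x) + \<sigma> / 2 * (norm (y - x))\<^sup>2 \<le> g y"
proof -
  let ?r = "\<lambda>t. g y - g x - \<sigma> / 2 * (1 - t) * (norm (y - x))\<^sup>2"
  have "w \<bullet> (y - x) \<le> g y - g x - \<sigma> / 2 * (1 - 0) * (norm (y - x))\<^sup>2"
  proof (rule tendsto_le[OF _ _ directional_derivative_from_gradient[OF w]])
    show "(?r \<longlongrightarrow> g y - g x - \<sigma> / 2 * (1 - 0) * (norm (y - x))\<^sup>2) (at_right 0)"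
      by (intro tendsto_intros)
    have "(g (x + t *\<^sub>R (y - x)) - g x) / t \<le> ?r t" if "0 < t" "t < 1" for t
    proof -
      have "t *\<^sub>R y + (1 - t) *\<^sub>R x = x + t *\<^sub>R (y - x)" by (simp add: algebra_simps)
      then have "g (x + t *\<^sub>R (y - x)) - g x \<le> t * ?r t"
        using sc[of t] that by (simp add: algebra_simps)
      then show ?thesis using that by (simp add: pos_divide_le_eq mult.commute)
    qed
    then show "\<forall>\<^sub>F t in at_right 0. (g (x + t *\<^sub>R (y - x)) - g x) / t \<le> ?r t"
      by (auto simp: eventually_at_right_field intro!: exI[of _ 1])
  qed simp
  then show ?thesis by simp
qed

text \<open>What the two kinds of loss have in common. The vector \<open>w\<close> is a gradient from above (first clause);
  the excess of \<open>l\<close> over its linearization grows quadratically with the violation of finitely many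
  linear constraints (second clause) and is at most \<open>0\<close> where these constraints hold (third clause). The
  constraints describe the single point \<open>y0\<close> for a strongly convex loss, and the set of \<open>y\<close> that
  have the same maximizer as \<open>y0\<close> for a max-type loss. Measuring growth by constraint violation,
  and not by distance, lets the constraints be merged with those of a polyhedral epigraph in a
  single application of Hoffman's bound.\<close>
definition polyhedral_growth_at :: "('a::euclidean_space \<Rightarrow> ereal) \<Rightarrow> 'a \<Rightarrow> bool" where
  "polyhedral_growth_at l y0 \<longleftrightarrow> (\<exists>w C \<kappa>. finite C \<and> 0 < \<kappa> \<and>
     (\<forall>\<eta>>0. \<forall>\<^sub>F y in nhds y0. l y \<le> l y0 + ereal (w \<bullet> (y - y0) + \<eta> * norm (y - y0))) \<and>
     (\<forall>\<^sub>F y in nhds y0. l y0 + ereal (w \<bullet> (y - y0) + \<kappa> * (violation C y)\<^sup>2) \<le> l y) \<and>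
     (\<forall>y\<in>halfspaces C. l y \<le> l y0 + ereal (w \<bullet> (y - y0))))"

text \<open>Passes from quadratic growth in each constraint to quadratic growth in the total violation. The
  \<open>+ 1\<close> keeps the constant positive when \<open>C\<close> is empty.\<close>
lemma violation_power2_le:
  assumes "\<And>c. c \<in> C \<Longrightarrow> \<kappa> * (max 0 (fst c \<bullet> y - snd c))\<^sup>2 \<le> \<Delta>" "0 \<le> \<Delta>" "0 < \<kappa>"
  shows "\<kappa> / (real (card C) + 1)\<^sup>2 * (violation C y)\<^sup>2 \<le> \<Delta>"
proof -
  let ?n = "real (card C) + 1"
  define B where "B = sqrt (\<Delta> / \<kappa>)"
  have B: "0 \<le> B" "\<kappa> * B\<^sup>2 = \<Delta>" unfolding B_def using assms(2,3) by auto
  have "fst c \<bullet> y - snd c \<le> B" if "c \<in> C" for c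
  proof -
    have "(max 0 (fst c \<bullet> y - snd c))\<^sup>2 \<le> \<Delta> / \<kappa>"
      using assms(1)[OF that] assms(3) by (simp add: field_simps)
    then have "max 0 (fst c \<bullet> y - snd c) \<le> B"
      unfolding B_def by (rule real_le_rsqrt)
    then show ?thesis by simp
  qed
  then have "violation C y \<le> real (card C) * B" using B(1) by (rule violation_le)
  also have "\<dots> \<le> ?n * B" using B(1) by (simp add: mult_right_mono)
  finally have "(violation C y)\<^sup>2 \<le> (?n * B)\<^sup>2"
    using violation_nonneg by (rule power_mono)
  then have "\<kappa> / ?n\<^sup>2 * (violation C y)\<^sup>2 \<le> \<kappa> / ?n\<^sup>2 * (?n * B)\<^sup>2"
    using assms(3) by (intro mult_left_mono) auto
  also have "\<dots> = \<Delta>" using B(2) by (simp add: power_mult_distrib)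
  finally show ?thesis .
qed

text \<open>Strong convexity on a small closed ball gives quadratic growth in the distance to \<open>y0\<close>, and the
  inequalities \<open>\<plusminus> b \<bullet> y \<le> \<plusminus> b \<bullet> y0\<close> over the basis vectors \<open>b\<close> cut out exactly \<open>{y0}\<close>.\<close>
lemma smooth_loss_polyhedral_growth:
  assumes l: "smooth_loss l" and y0: "y0 \<in> edom l"
  shows "polyhedral_growth_at l y0"
proof -
  define g where "g = (\<lambda>y. real_of_ereal (l y))"
  have op: "open (edom l)" and pr: "proper_fun l"
    using l unfolding smooth_loss_def by auto
  have lg: "l y = ereal (g y)" if "y \<in> edom l" for y
    using that pr unfolding g_def edom_def proper_fun_def by (metis ereal_real less_ereal.simps(2) mem_Collect_eq
        abs_ereal.cases ereal_infinity_cases linorder_not_less order_refl)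
  obtain r where r: "r > 0" "cball y0 r \<subseteq> edom l"
    using op y0 open_contains_cball by blast
  have "strongly_convex_on (cball y0 r) g"
    using l r(2) unfolding smooth_loss_def g_def by auto
  then obtain \<sigma> where \<sigma>: "\<sigma> > 0" and
    sc: "\<And>x y t. x \<in> cball y0 r \<Longrightarrow> y \<in> cball y0 r \<Longrightarrow> t \<in> {0..1} \<Longrightarrow>
       g (t *\<^sub>R x + (1 - t) *\<^sub>R y)
         \<le> t * g x + (1 - t) * g y - \<sigma> / 2 * t * (1 - t) * (norm (x - y))\<^sup>2"
    unfolding strongly_convex_on_def by blast
  obtain w where w: "GDERIV g y0 :> w"
    using l y0 unfolding smooth_loss_def twice_cont_diff_on_def g_def by blast
  have grow: "g y0 + w \<bullet> (y - y0) + \<sigma> / 2 * (norm (y - y0))\<^sup>2 \<le> g y" if "y \<in> cball y0 r" for y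
    by (rule strongly_convex_gradient_growth[OF _ w], rule sc) (use that r in auto)
  have near: "\<forall>\<^sub>F y in nhds y0. y \<in> cball y0 r"
    unfolding eventually_nhds_metric using r(1) by (metis dist_commute less_le mem_cball)
  define C where "C = (\<lambda>b. (b, b \<bullet> y0)) ` Basis \<union> (\<lambda>b. (- b, - (b \<bullet> y0))) ` (Basis :: 'a set)"
  have finC: "finite C" unfolding C_def by simp
  define \<kappa> where "\<kappa> = \<sigma> / 2 / (real (card C) + 1)\<^sup>2"
  have "\<kappa> > 0" unfolding \<kappa>_def using \<sigma> by simp
  moreover have "\<forall>\<^sub>F y in nhds y0. l y \<le> l y0 + ereal (w \<bullet> (y - y0) + \<eta> * norm (y - y0))" if "\<eta> > 0" for \<eta>
  proof -
    have "(g has_derivative (\<lambda>h. h \<bullet> w)) (at y0)" using w by (simp add: gderiv_def)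
    then have "\<forall>e>0. \<exists>d>0. \<forall>y. norm (y - y0) < d \<longrightarrow> norm (g y - g y0 - (y - y0) \<bullet> w) \<le> e * norm (y - y0)"
      unfolding has_derivative_at_alt by (rule conjunct2)
    from this[rule_format, OF that] obtain d where d: "d > 0"
      "\<And>y. norm (y - y0) < d \<Longrightarrow> norm (g y - g y0 - (y - y0) \<bullet> w) \<le> \<eta> * norm (y - y0)"
      by metis
    have "\<forall>\<^sub>F y in nhds y0. norm (y - y0) < d"
      unfolding eventually_nhds_metric using d(1) by (auto simp: dist_norm)
    with near show ?thesis
    proof eventually_elim
      case (elim y)
      have "g y \<le> g y0 + (w \<bullet> (y - y0) + \<eta> * norm (y - y0))"
        using d(2)[OF elim(2)] by (simp add: inner_commute[of w])
      then show ?case using elim(1) r(2) lg y0 by (simp add: subset_iff)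
    qed
  qed
  moreover have "\<forall>\<^sub>F y in nhds y0. l y0 + ereal (w \<bullet> (y - y0) + \<kappa> * (violation C y)\<^sup>2) \<le> l y"
    using near
  proof eventually_elim
    case (elim y)
    have "\<kappa> * (violation C y)\<^sup>2 \<le> \<sigma> / 2 * (norm (y - y0))\<^sup>2"
      unfolding \<kappa>_def
    proof (rule violation_power2_le)
      fix c assume "c \<in> C"
      then obtain b where b: "b \<in> Basis" "fst c \<bullet> y - snd c = b \<bullet> (y - y0) \<or> fst c \<bullet> y - snd c = - (b \<bullet> (y - y0))"
        unfolding C_def by (auto simp: inner_diff_right)
      have "\<bar>b \<bullet> (y - y0)\<bar> \<le> norm (y - y0)"
        using Basis_le_norm[OF b(1), of "y - y0"] by (simp add: inner_commute)
      then have "max 0 (fst c \<bullet> y - snd c) \<le> norm (y - y0)" using b(2) by auto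
      then have "(max 0 (fst c \<bullet> y - snd c))\<^sup>2 \<le> (norm (y - y0))\<^sup>2"
        by (rule power_mono) auto
      then show "\<sigma> / 2 * (max 0 (fst c \<bullet> y - snd c))\<^sup>2 \<le> \<sigma> / 2 * (norm (y - y0))\<^sup>2"
        using \<sigma> by simp
    qed (use \<sigma> in auto)
    then have "g y0 + (w \<bullet> (y - y0) + \<kappa> * (violation C y)\<^sup>2) \<le> g y"
      using grow[OF elim] by linarith
    then show ?case using elim r(2) lg y0 by (simp add: subset_iff)
  qed
  moreover have "\<forall>y\<in>halfspaces C. l y \<le> l y0 + ereal (w \<bullet> (y - y0))"
  proof
    fix y assume "y \<in> halfspaces C"
    then have "y \<bullet> b = y0 \<bullet> b" if "b \<in> Basis" for b
    proof -
      have "(b, b \<bullet> y0) \<in> C" "(- b, - (b \<bullet> y0)) \<in> C" unfolding C_def using that by auto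
      then have "b \<bullet> y \<le> b \<bullet> y0" "- b \<bullet> y \<le> - (b \<bullet> y0)"
        using \<open>y \<in> halfspaces C\<close> unfolding halfspaces_def by fastforce+
      then show ?thesis by (simp add: inner_commute)
    qed
    then have "y = y0" by (rule euclidean_eqI)
    then show "l y \<le> l y0 + ereal (w \<bullet> (y - y0))" by simp
  qed
  ultimately show ?thesis unfolding polyhedral_growth_at_def using finC by blast
qed

text \<open>The normal cone of a polyhedron at \<open>u0\<close> is given by finitely many inequalities: intersect \<open>D\<close> with
  a box around \<open>u0\<close> and take the vertices of the resulting polytope. By convexity the box does not
  change the normal cone, since every segment from \<open>u0\<close> into \<open>D\<close> starts inside it.\<close>
lemma normal_cone_generators:
  fixes D :: "'a::euclidean_space set"
  assumes "polyhedron D" "u0 \<in> D"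
  obtains V where "finite V" "V \<subseteq> D"
    "\<And>z u. (\<forall>v\<in>V. z \<bullet> (v - u0) \<le> 0) \<Longrightarrow> u \<in> D \<Longrightarrow> z \<bullet> (u - u0) \<le> 0"
proof -
  define B where "B = cbox (u0 - One) (u0 + One)"
  have "polytope (D \<inter> B)"
    unfolding polytope_eq_bounded_polyhedron B_def using assms(1)
    by (auto intro: bounded_subset[OF bounded_cbox])
  then obtain V where V: "finite V" "D \<inter> B = convex hull V"
    unfolding polytope_def by blast
  show thesis
  proof (rule that[OF V(1)])
    show "V \<subseteq> D" using V(2) hull_subset[of V convex] by blast
    fix z u assume z: "\<forall>v\<in>V. z \<bullet> (v - u0) \<le> 0" and u: "u \<in> D"
    have sub: "convex hull V \<subseteq> {x. z \<bullet> x \<le> z \<bullet> u0}"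
      by (rule hull_minimal) (use z in \<open>auto simp: inner_diff_right convex_halfspace_le\<close>)
    \<comment> \<open>This step length brings the point \<open>u0 + t (u - u0)\<close> into the box.\<close>
    define t where "t = 1 / (1 + norm (u - u0))"
    have t: "0 < t" "t \<le> 1" "t * norm (u - u0) \<le> 1"
      unfolding t_def by (auto simp: divide_simps add_pos_nonneg add_nonneg_eq_0_iff)
    have "(1 - t) *\<^sub>R u0 + t *\<^sub>R u \<in> D"
      using polyhedron_imp_convex[OF assms(1)] assms(2) u t by (simp add: convexD_alt)
    then have "u0 + t *\<^sub>R (u - u0) \<in> D" by (simp add: algebra_simps)
    moreover have "u0 + t *\<^sub>R (u - u0) \<in> B"
    proof -
      have "\<bar>t * ((u - u0) \<bullet> b)\<bar> \<le> 1" if "b \<in> Basis" for b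
      proof -
        have "\<bar>t * ((u - u0) \<bullet> b)\<bar> = t * \<bar>(u - u0) \<bullet> b\<bar>" using t(1) by (simp add: abs_mult)
        also have "\<dots> \<le> t * norm (u - u0)" using Basis_le_norm[OF that] t(1) by (intro mult_left_mono) auto
        finally show ?thesis using t(3) by simp
      qed
      then show ?thesis unfolding B_def mem_box
        by (simp add: inner_diff_left inner_add_left abs_le_iff)
    qed
    ultimately have "z \<bullet> (u0 + t *\<^sub>R (u - u0)) \<le> z \<bullet> u0" using V(2) sub by blast
    then show "z \<bullet> (u - u0) \<le> 0" using t(1) by (simp add: inner_add_right mult_le_0_iff)
  qed
qed

text \<open>Let \<open>u0\<close> be the maximizer at \<open>y0\<close>; it is the gradient of \<open>l\<close> there, because strong convexity of
  \<open>q\<close> makes the maximum strict with quadratic decay. It stays a maximizer exactly for those \<open>y\<close>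
  for which \<open>y - \<nabla>q(u0)\<close> is normal to \<open>D\<close> at \<open>u0\<close>, a polyhedral condition by the preceding lemma.
  If \<open>y\<close> violates by \<open>m\<close> the inequality belonging to a vertex \<open>v\<close>, then moving from \<open>u0\<close> towards
  \<open>v\<close> gains \<open>m\<close> to first order and loses at most a quadratic term, since \<open>\<nabla>q\<close> is Lipschitz; the
  best step gains a multiple of \<open>m\<^sup>2\<close>.\<close>
lemma max_loss_polyhedral_growth:
  assumes "max_loss l"
  shows "polyhedral_growth_at l y0"
proof -
  obtain D q where D: "polyhedron D" and q: "strongly_convex_on UNIV q" and "lipschitz_gradient q"
    and att: "\<And>y. \<exists>u\<in>D. l y = ereal (y \<bullet> u - q u) \<and> (\<forall>w\<in>D. y \<bullet> w - q w \<le> y \<bullet> u - q u)"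
    using assms unfolding max_loss_def by blast
  then obtain G L0 where G: "\<And>x. GDERIV q x :> G x" and "L0-lipschitz_on UNIV G"
    unfolding lipschitz_gradient_def by blast
  define L where "L = max L0 1"
  have L: "1 \<le> L" "norm (G x - G y) \<le> L * norm (x - y)" for x y
    using \<open>L0-lipschitz_on UNIV G\<close> mult_right_mono[of L0 L "norm (x - y)"]
    unfolding lipschitz_on_def L_def dist_norm by (auto intro: order_trans)
  obtain \<sigma> where \<sigma>: "\<sigma> > 0" and
    sc: "\<And>x y t. t \<in> {0..1} \<Longrightarrow> q (t *\<^sub>R x + (1 - t) *\<^sub>R y)
         \<le> t * q x + (1 - t) * q y - \<sigma> / 2 * t * (1 - t) * (norm (x - y))\<^sup>2"
    using q unfolding strongly_convex_on_def by blast
  have qgrow: "q x + G x \<bullet> (y - x) + \<sigma> / 2 * (norm (y - x))\<^sup>2 \<le> q y" for x y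
    by (rule strongly_convex_gradient_growth[OF _ G], rule sc)
  have qconv: "q x + G x \<bullet> (y - x) \<le> q y" for x y
    using qgrow[of x y] \<sigma> by (smt (verit, ccfv_SIG) divide_pos_pos mult_nonneg_nonneg zero_le_power2)
  have lge: "ereal (y \<bullet> u - q u) \<le> l y" if "u \<in> D" for y u
    using att[of y] that by auto
  have lle: "l y \<le> ereal B" if "\<And>u. u \<in> D \<Longrightarrow> y \<bullet> u - q u \<le> B" for y B
    using att[of y] that by auto
  obtain u0 where u0: "u0 \<in> D" "l y0 = ereal (y0 \<bullet> u0 - q u0)"
    and max0: "\<And>w. w \<in> D \<Longrightarrow> y0 \<bullet> w - q w \<le> y0 \<bullet> u0 - q u0"
    using att[of y0] by blast
  have ly0: "l y0 + ereal (u0 \<bullet> (y - y0) + e) = ereal (y \<bullet> u0 - q u0 + e)" for y e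
    unfolding u0(2) by (simp add: algebra_simps inner_commute)
  define z0 where "z0 = y0 - G u0"
  \<comment> \<open>First-order optimality: \<open>y0 - \<nabla>q(u0)\<close> is normal to \<open>D\<close> at the maximizer \<open>u0\<close>.\<close>
  have z0: "z0 \<bullet> (u - u0) \<le> 0" if u: "u \<in> D" for u
  proof -
    have "y0 \<bullet> (u - u0) \<le> G u0 \<bullet> (u - u0)"
    proof (rule tendsto_le[OF _ directional_derivative_from_gradient[OF G] tendsto_const])
      have "y0 \<bullet> (u - u0) \<le> (q (u0 + t *\<^sub>R (u - u0)) - q u0) / t" if "0 < t" "t < 1" for t
      proof -
        have "(1 - t) *\<^sub>R u0 + t *\<^sub>R u \<in> D"
          using polyhedron_imp_convex[OF D] u0(1) u that by (simp add: convexD_alt)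
        then have "u0 + t *\<^sub>R (u - u0) \<in> D" by (simp add: algebra_simps)
        from max0[OF this] have "t * (y0 \<bullet> (u - u0)) \<le> q (u0 + t *\<^sub>R (u - u0)) - q u0"
          by (simp add: inner_add_right)
        then show ?thesis using that by (simp add: pos_le_divide_eq mult.commute)
      qed
      then show "\<forall>\<^sub>F t in at_right 0. y0 \<bullet> (u - u0) \<le> (q (u0 + t *\<^sub>R (u - u0)) - q u0) / t"
        by (auto simp: eventually_at_right_field intro!: exI[of _ 1])
    qed simp
    then show ?thesis unfolding z0_def by (simp add: inner_diff_left)
  qed
  obtain V where V: "finite V" "V \<subseteq> D"
    and Vgen: "\<And>z u. (\<forall>v\<in>V. z \<bullet> (v - u0) \<le> 0) \<Longrightarrow> u \<in> D \<Longrightarrow> z \<bullet> (u - u0) \<le> 0"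
    using normal_cone_generators[OF D u0(1)] by blast
  define C where "C = (\<lambda>v. (v - u0, G u0 \<bullet> (v - u0))) ` V"
  have finC: "finite C" unfolding C_def using V(1) by simp
  define R where "R = 1 + (\<Sum>v\<in>V. norm (v - u0))"
  have R: "1 \<le> R" "\<And>v. v \<in> V \<Longrightarrow> norm (v - u0) \<le> R"
    unfolding R_def using V(1) member_le_sum[of _ V "\<lambda>v. norm (v - u0)"]
    by (auto intro!: sum_nonneg add_increasing)
  define k where "k = 1 / (4 * L * R\<^sup>2)"
  have LR: "1 \<le> L * R\<^sup>2" using L(1) R(1) by (simp add: mult_ge1_I)
  have k: "k > 0" unfolding k_def using LR by simp
  define \<kappa> where "\<kappa> = k / (real (card C) + 1)\<^sup>2"
  have "\<kappa> > 0" unfolding \<kappa>_def using k by (simp add: add_nonneg_pos)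
  moreover have "\<forall>\<^sub>F y in nhds y0. l y \<le> l y0 + ereal (u0 \<bullet> (y - y0) + \<eta> * norm (y - y0))" if "\<eta> > 0" for \<eta>
  proof -
    have "\<forall>\<^sub>F y in nhds y0. norm (y - y0) < 2 * \<sigma> * \<eta>"
      unfolding eventually_nhds_metric using \<sigma> that by (intro exI[of _ "2 * \<sigma> * \<eta>"]) (auto simp: dist_norm)
    then show ?thesis
    proof eventually_elim
      case (elim y)
      show ?case unfolding ly0
      proof (rule lle)
        fix u assume u: "u \<in> D"
        let ?n = "norm (y - y0)" and ?m = "norm (u - u0)"
        have "z0 \<bullet> (u - u0) \<le> 0" by (rule z0[OF u])
        then have 1: "y0 \<bullet> (u - u0) \<le> q u - q u0 - \<sigma> / 2 * ?m\<^sup>2"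
          using qgrow[of u0 u] unfolding z0_def by (simp add: inner_diff_left)
        have "(y - y0) \<bullet> (u - u0) \<le> ?n * ?m" by (rule norm_cauchy_schwarz)
        moreover have "?n * ?m \<le> ?n\<^sup>2 / (2 * \<sigma>) + \<sigma> / 2 * ?m\<^sup>2"
        proof -
          have "0 \<le> (?n - \<sigma> * ?m)\<^sup>2 / (2 * \<sigma>)" using \<sigma> by simp
          also have "\<dots> = ?n\<^sup>2 / (2 * \<sigma>) + \<sigma> / 2 * ?m\<^sup>2 - ?n * ?m"
            using \<sigma> by (simp add: power2_eq_square field_simps)
          finally show ?thesis by simp
        qed
        moreover have "?n\<^sup>2 / (2 * \<sigma>) \<le> \<eta> * ?n"
        proof -
          have "?n * ?n \<le> 2 * \<sigma> * \<eta> * ?n" using elim by (intro mult_right_mono) auto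
          then show ?thesis using \<sigma> by (simp add: power2_eq_square field_simps)
        qed
        ultimately have "(y - y0) \<bullet> (u - u0) \<le> \<eta> * ?n + \<sigma> / 2 * ?m\<^sup>2" by linarith
        with 1 show "y \<bullet> u - q u \<le> y \<bullet> u0 - q u0 + \<eta> * ?n"
          by (simp add: inner_diff_left inner_diff_right)
      qed
    qed
  qed
  moreover have "\<forall>\<^sub>F y in nhds y0. l y0 + ereal (u0 \<bullet> (y - y0) + \<kappa> * (violation C y)\<^sup>2) \<le> l y"
  proof -
    have "\<forall>\<^sub>F y in nhds y0. norm (y - y0) < 1"
      unfolding eventually_nhds_metric by (intro exI[of _ 1]) (auto simp: dist_norm)
    then show ?thesis
    proof eventually_elim
      case (elim y)
      obtain a where a: "l y = ereal a" using att[of y] by blast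
      define \<Delta> where "\<Delta> = a - (y \<bullet> u0 - q u0)"
      have \<Delta>ge: "y \<bullet> u - q u - (y \<bullet> u0 - q u0) \<le> \<Delta>" if "u \<in> D" for u
        using lge[OF that, of y] unfolding a \<Delta>_def by simp
      have "\<kappa> * (violation C y)\<^sup>2 \<le> \<Delta>"
        unfolding \<kappa>_def
      proof (rule violation_power2_le)
        show "0 \<le> \<Delta>" using \<Delta>ge[OF u0(1)] by simp
        fix c assume "c \<in> C"
        then obtain v where v: "v \<in> V" and c: "fst c \<bullet> y - snd c = (y - G u0) \<bullet> (v - u0)"
          unfolding C_def by (auto simp: inner_commute inner_diff_left inner_diff_right)
        define m where "m = max 0 ((y - G u0) \<bullet> (v - u0))"
        have m0: "0 \<le> m" unfolding m_def by simp
        have "(y - G u0) \<bullet> (v - u0) = z0 \<bullet> (v - u0) + (y - y0) \<bullet> (v - u0)"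
          unfolding z0_def by (simp add: inner_diff_left)
        also have "\<dots> \<le> (y - y0) \<bullet> (v - u0)" using z0 v V(2) by auto
        also have "\<dots> \<le> norm (y - y0) * norm (v - u0)" by (rule norm_cauchy_schwarz)
        also have "\<dots> \<le> 1 * R" using elim R(2)[OF v] by (intro mult_mono) auto
        finally have mR: "m \<le> R" unfolding m_def using R(1) by simp
        \<comment> \<open>The step \<open>s\<close> maximizes the quadratic lower bound \<open>s m - L s\<^sup>2 R\<^sup>2\<close> of the gain along \<open>v - u0\<close>.\<close>
        define s where "s = m / (2 * L * R\<^sup>2)"
        have s0: "0 \<le> s" unfolding s_def using m0 LR by simp
        have "R \<le> R\<^sup>2" using R(1) by (simp add: power2_eq_square)
        also have "R\<^sup>2 \<le> 2 * L * R\<^sup>2" using L(1) mult_right_mono[of 1 "2 * L" "R\<^sup>2"] by simp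
        finally have s1: "s \<le> 1" unfolding s_def using mR LR by (simp add: pos_divide_le_eq)
        define u where "u = u0 + s *\<^sub>R (v - u0)"
        have "(1 - s) *\<^sub>R u0 + s *\<^sub>R v \<in> D"
          using polyhedron_imp_convex[OF D] u0(1) v V(2) s0 s1 by (simp add: convexD_alt subset_iff)
        then have uD: "u \<in> D" unfolding u_def by (simp add: algebra_simps)
        have "q u \<le> q u0 + G u \<bullet> (u - u0)"
          using qconv[of u u0] by (simp add: inner_diff_right)
        also have "G u \<bullet> (u - u0) = G u0 \<bullet> (u - u0) + (G u - G u0) \<bullet> (u - u0)"
          by (simp add: inner_diff_left)
        also have "(G u - G u0) \<bullet> (u - u0) \<le> L * norm (u - u0) * norm (u - u0)"
          using norm_cauchy_schwarz[of "G u - G u0" "u - u0"] mult_right_mono[OF L(2)[of u u0], of "norm (u - u0)"]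
          by simp
        also have "L * norm (u - u0) * norm (u - u0) \<le> L * (s * R) * (s * R)"
        proof -
          have "norm (u - u0) \<le> s * R"
            unfolding u_def using s0 R(2)[OF v] by (simp add: mult_left_mono)
          then show ?thesis using s0 L(1) R(1) by (intro mult_mono mult_nonneg_nonneg) auto
        qed
        finally have "q u \<le> q u0 + (G u0 \<bullet> (u - u0) + L * (s * R) * (s * R))" by linarith
        then have "y \<bullet> u - q u - (y \<bullet> u0 - q u0) \<ge> (y - G u0) \<bullet> (u - u0) - L * (s * R) * (s * R)"
          by (simp add: inner_diff_left inner_diff_right)
        moreover have "(y - G u0) \<bullet> (u - u0) = s * m"
          unfolding u_def s_def m_def by (auto simp: max_def)
        moreover have "s * m - L * (s * R) * (s * R) = k * m\<^sup>2"
          unfolding s_def k_def using L(1) R(1) by (simp add: power2_eq_square field_simps)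
        ultimately show "k * (max 0 (fst c \<bullet> y - snd c))\<^sup>2 \<le> \<Delta>"
          using \<Delta>ge[OF uD] unfolding c m_def by linarith
      qed (use k in auto)
      then show ?case unfolding ly0 a \<Delta>_def by simp
    qed
  qed
  moreover have "\<forall>y\<in>halfspaces C. l y \<le> l y0 + ereal (u0 \<bullet> (y - y0))"
  proof
    fix y assume y: "y \<in> halfspaces C"
    have "l y \<le> l y0 + ereal (u0 \<bullet> (y - y0) + 0)"
      unfolding ly0
    proof (rule lle)
      fix u assume u: "u \<in> D"
      have "\<forall>v\<in>V. (y - G u0) \<bullet> (v - u0) \<le> 0"
        using y unfolding halfspaces_def C_def by (auto simp: inner_commute inner_diff_left inner_diff_right)
      then have "(y - G u0) \<bullet> (u - u0) \<le> 0" using u by (rule Vgen)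
      then show "y \<bullet> u - q u \<le> y \<bullet> u0 - q u0 + 0"
        using qconv[of u0 u] by (simp add: inner_diff_left inner_diff_right)
    qed
    then show "l y \<le> l y0 + ereal (u0 \<bullet> (y - y0))" by simp
  qed
  ultimately show ?thesis unfolding polyhedral_growth_at_def using finC by blast
qed

text \<open>A pointwise maximum of affine functions: its epigraph is an intersection of halfspaces.\<close>
lemma max_loss_convex:
  assumes "max_loss l"
  shows "convex_fun l"
proof -
  obtain D q where att: "\<And>y. \<exists>u\<in>D. l y = ereal (y \<bullet> u - q u) \<and> (\<forall>w\<in>D. y \<bullet> w - q w \<le> y \<bullet> u - q u)"
    using assms unfolding max_loss_def by blast
  have "l y \<le> ereal s \<longleftrightarrow> (\<forall>w\<in>D. (w, -1) \<bullet> (y, s) \<le> q w)" for y and s :: real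
    using att[of y] by (force simp: inner_commute algebra_simps)
  then have "eepigraph l = (\<Inter>w\<in>D. {p. (w, -1) \<bullet> p \<le> q w})"
    unfolding eepigraph_def by auto
  then show ?thesis unfolding convex_fun_def by (auto intro: convex_INT convex_halfspace_le)
qed

section \<open>Convex subgradients of convex pieces\<close>

definition convex_subgradient :: "('a::real_inner \<Rightarrow> ereal) \<Rightarrow> 'a \<Rightarrow> 'a \<Rightarrow> bool" where
  "convex_subgradient g x v \<longleftrightarrow> (\<forall>z. g x + ereal (v \<bullet> (z - x)) \<le> g z)"

lemma ereal_add_eq_realE:
  fixes u v :: ereal
  assumes "u + v = ereal s" "u \<noteq> -\<infinity>" "v \<noteq> -\<infinity>"
  obtains a b where "u = ereal a" "v = ereal b" "s = a + b"
  using assms by (cases u; cases v) auto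

lemma convex_funD:
  assumes "convex_fun h" "h x \<le> ereal a" "h y \<le> ereal b" "0 \<le> t" "t \<le> 1"
  shows "h ((1 - t) *\<^sub>R x + t *\<^sub>R y) \<le> ereal ((1 - t) * a + t * b)"
proof -
  have "(1 - t) *\<^sub>R (x, a) + t *\<^sub>R (y, b) \<in> eepigraph h"
    by (rule convexD_alt) (use assms in \<open>auto simp: convex_fun_def eepigraph_def\<close>)
  then show ?thesis by (simp add: eepigraph_def)
qed

lemma convex_fun_compose_linear_add:
  assumes l: "convex_fun l" and P: "convex_fun P" and T: "linear T"
    and l_inf: "\<And>y. l y \<noteq> -\<infinity>" and P_inf: "\<And>x. P x \<noteq> -\<infinity>"
  shows "convex_fun (\<lambda>x. l (T x) + P x)"
  unfolding convex_fun_def convex_alt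
proof (intro ballI allI impI)
  fix X Y and t :: real
  assume X: "X \<in> eepigraph (\<lambda>x. l (T x) + P x)" and Y: "Y \<in> eepigraph (\<lambda>x. l (T x) + P x)"
    and t: "0 \<le> t \<and> t \<le> 1"
  have split: "\<exists>a b. l (T x) \<le> ereal a \<and> P x \<le> ereal b \<and> a + b = s"
    if le: "l (T x) + P x \<le> ereal s" for x s
  proof -
    obtain a where a: "l (T x) = ereal a"
      using le l_inf[of "T x"] P_inf[of x] by (cases "l (T x)"; cases "P x") auto
    have "P x \<le> ereal (s - a)" using le P_inf[of x] unfolding a by (cases "P x") auto
    then show ?thesis using a by (intro exI[of _ a] exI[of _ "s - a"]) auto
  qed
  obtain x s y s' where XY: "X = (x, s)" "Y = (y, s')" by (metis surj_pair)
  obtain a b where ab: "l (T x) \<le> ereal a" "P x \<le> ereal b" "s = a + b"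
    using split[of x s] X unfolding XY eepigraph_def by auto
  obtain a' b' where ab': "l (T y) \<le> ereal a'" "P y \<le> ereal b'" "s' = a' + b'"
    using split[of y s'] Y unfolding XY eepigraph_def by auto
  have "T ((1 - t) *\<^sub>R x + t *\<^sub>R y) = (1 - t) *\<^sub>R T x + t *\<^sub>R T y"
    using T by (simp add: linear_add linear_scale)
  then have "l (T ((1 - t) *\<^sub>R x + t *\<^sub>R y)) + P ((1 - t) *\<^sub>R x + t *\<^sub>R y)
      \<le> ereal ((1 - t) * a + t * a') + ereal ((1 - t) * b + t * b')"
    using convex_funD[OF l ab(1) ab'(1)] convex_funD[OF P ab(2) ab'(2)] t
    by (intro add_mono) auto
  then show "(1 - t) *\<^sub>R X + t *\<^sub>R Y \<in> eepigraph (\<lambda>x. l (T x) + P x)"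
    unfolding XY eepigraph_def ab(3) ab'(3) by (simp add: algebra_simps)
qed

text \<open>A regular subgradient of \<open>f\<close> at \<open>x\<close> is one of every function \<open>g \<ge> f\<close> that agrees with \<open>f\<close> at \<open>x\<close>,
  and for convex \<open>g\<close> the local inequality is global: a point \<open>z\<close> below the affine minorant would, by
  convexity, keep the difference quotient along the segment from \<open>x\<close> to \<open>z\<close> below a fixed negative
  number. This reduces a minimum of convex functions to its convex pieces.\<close>
lemma regular_subgradient_of_touching_minorant:
  assumes g: "convex_fun g" and gx: "g x = ereal a" and fx: "f x = g x" and fg: "\<And>z. f z \<le> g z"
    and v: "v \<in> regular_subdiff f x"
  shows "convex_subgradient g x v"
  unfolding convex_subgradient_def
proof
  fix z
  show "g x + ereal (v \<bullet> (z - x)) \<le> g z"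
  proof (rule ccontr)
    assume neg: "\<not> g x + ereal (v \<bullet> (z - x)) \<le> g z"
    obtain b where b: "g z \<le> ereal b" "b < a + v \<bullet> (z - x)"
    proof -
      have "g z < ereal (a + v \<bullet> (z - x))" using neg unfolding gx by simp
      then obtain e where "g z < e" "e < ereal (a + v \<bullet> (z - x))" using dense by blast
      then show thesis using that[of "real_of_ereal e"] by (cases e) auto
    qed
    define d where "d = norm (z - x)"
    define \<eta> where "\<eta> = a + v \<bullet> (z - x) - b"
    have \<eta>: "\<eta> > 0" unfolding \<eta>_def using b by simp
    have zx: "z \<noteq> x" using neg by (auto simp: gx zero_ereal_def[symmetric])
    then have d: "d > 0" unfolding d_def by simp
    let ?Q = "\<lambda>z. (f z - f x - ereal (v \<bullet> (z - x))) / ereal (norm (z - x))"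
    have "0 \<le> Liminf (at x) ?Q"
      using v unfolding regular_subdiff_def by (auto split: if_splits)
    moreover have "ereal (- (\<eta> / d)) < 0" using \<eta> d by simp
    ultimately have "\<forall>\<^sub>F y in at x. ereal (- (\<eta> / d)) < ?Q y"
      unfolding le_Liminf_iff by blast
    moreover have "filterlim (\<lambda>t. x + t *\<^sub>R (z - x)) (at x) (at_right (0::real))"
    proof -
      have "((\<lambda>t::real. x + t *\<^sub>R (z - x)) \<longlongrightarrow> x + 0 *\<^sub>R (z - x)) (at_right 0)"
        by (intro tendsto_intros)
      moreover have "\<forall>\<^sub>F t in at_right (0::real). x + t *\<^sub>R (z - x) \<noteq> x"
        using eventually_at_right_less[of "0::real"] by eventually_elim (use zx in auto)
      ultimately show ?thesis unfolding filterlim_at by simp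
    qed
    ultimately have "\<forall>\<^sub>F t in at_right 0. ereal (- (\<eta> / d)) < ?Q (x + t *\<^sub>R (z - x))"
      unfolding filterlim_iff by blast
    moreover have "\<forall>\<^sub>F t in at_right (0::real). 0 < t \<and> t < 1"
      by (auto simp: eventually_at_right_field intro!: exI[of _ 1])
    ultimately have "\<forall>\<^sub>F t in at_right 0. 0 < t \<and> t < 1 \<and> ereal (- (\<eta> / d)) < ?Q (x + t *\<^sub>R (z - x))"
      by eventually_elim auto
    from eventually_happens'[OF _ this] obtain t :: real where t: "0 < t" "t < 1"
      and Q: "ereal (- (\<eta> / d)) < ?Q (x + t *\<^sub>R (z - x))" by auto
    have "f (x + t *\<^sub>R (z - x)) \<le> g ((1 - t) *\<^sub>R x + t *\<^sub>R z)"
      using fg[of "x + t *\<^sub>R (z - x)"] by (simp add: algebra_simps)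
    also have "\<dots> \<le> ereal ((1 - t) * a + t * b)"
      using convex_funD[OF g _ b(1), of x a t] gx t by simp
    also have "(1 - t) * a + t * b = a + t * (v \<bullet> (z - x)) - t * \<eta>"
      unfolding \<eta>_def by (simp add: algebra_simps)
    finally have F: "f (x + t *\<^sub>R (z - x)) \<le> ereal (a + t * (v \<bullet> (z - x)) - t * \<eta>)" .
    have "?Q (x + t *\<^sub>R (z - x)) = (f (x + t *\<^sub>R (z - x)) - ereal a - ereal (t * (v \<bullet> (z - x)))) / ereal (t * d)"
      unfolding fx gx d_def using t by simp
    also have "\<dots> \<le> ereal (- (\<eta> / d))"
    proof (cases "f (x + t *\<^sub>R (z - x))")
      case (real r)
      then have "(r - a - t * (v \<bullet> (z - x))) / (t * d) \<le> - (t * \<eta>) / (t * d)"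
        using F t d by (intro divide_right_mono) auto
      then show ?thesis using real t d by simp
    qed (use F t d in auto)
    finally show False using Q by simp
  qed
qed

section \<open>Slope bounds for a single piece\<close>

text \<open>The inequality of exponent \<open>1/2\<close> with respect to the convex subgradients of one piece \<open>g\<close>. The level
  \<open>a\<close> is kept apart from \<open>g x0\<close>, because a piece that is inactive at \<open>x0\<close> has to be compared with
  the value of the minimum.\<close>
definition sqrt_slope_bound :: "('a::real_inner \<Rightarrow> ereal) \<Rightarrow> 'a \<Rightarrow> real \<Rightarrow> bool" where
  "sqrt_slope_bound g x0 a \<longleftrightarrow> (\<exists>c \<epsilon> \<nu>. 0 < c \<and> 0 < \<epsilon> \<and> 0 < \<nu> \<and>
     (\<forall>x v p. norm (x - x0) < \<epsilon> \<longrightarrow> g x = ereal p \<longrightarrow> a < p \<longrightarrow> p < a + \<nu> \<longrightarrow>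
        convex_subgradient g x v \<longrightarrow> c * sqrt (p - a) \<le> norm v))"

lemma linear_tendsto_nhds:
  fixes T :: "'a::euclidean_space \<Rightarrow> 'b::euclidean_space"
  assumes "linear T"
  shows "(T \<longlongrightarrow> T x) (nhds x)"
proof -
  have "isCont T x" using assms by (simp add: linear_continuous_at linear_conv_bounded_linear)
  then show ?thesis unfolding continuous_at by (rule tendsto_compose[OF _ filterlim_ident])
qed

text \<open>If \<open>g\<close> takes a value \<open>b < a\<close> at some \<open>z\<close>, then a subgradient at any point near \<open>x0\<close> of value above
  \<open>a\<close> has to account for a decrease of at least \<open>a - b\<close> over a bounded distance, so its norm is
  bounded away from zero.\<close>
lemma slope_bound_at_nonminimizer:
  assumes a: "ereal b = g z" "b < a"
  shows "sqrt_slope_bound g x0 a"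
proof -
  define R where "R = norm (z - x0) + 1"
  have R: "R > 0" unfolding R_def by (simp add: add_nonneg_pos)
  have "(a - b) / R * sqrt (p - a) \<le> norm v"
    if "norm (x - x0) < 1" "g x = ereal p" "a < p" "p < a + 1" "convex_subgradient g x v" for x v p
  proof -
    have "p + v \<bullet> (z - x) \<le> b"
      using that(5,2) a(1)[symmetric] unfolding convex_subgradient_def
      by (metis ereal_less_eq(3) plus_ereal.simps(1))
    moreover have "- (v \<bullet> (z - x)) \<le> norm v * norm (z - x)"
      using Cauchy_Schwarz_ineq2[of v "z - x"] by linarith
    moreover have "norm v * norm (z - x) \<le> norm v * R"
    proof (rule mult_left_mono)
      show "norm (z - x) \<le> R"
        using that(1) norm_triangle_ineq4[of "z - x0" "x - x0"] unfolding R_def by simp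
    qed simp
    ultimately have "a - b \<le> norm v * R" using that(3) by linarith
    then have "(a - b) / R \<le> norm v" using R by (simp add: pos_divide_le_eq)
    moreover have "(a - b) / R * sqrt (p - a) \<le> (a - b) / R * 1"
      using a(2) R that(3,4) by (intro mult_left_mono) auto
    ultimately show ?thesis by linarith
  qed
  then show ?thesis unfolding sqrt_slope_bound_def
    using a(2) R by (intro exI[of _ "(a - b) / R"] exI[of _ 1]) auto
qed

text \<open>With \<open>w\<close> the gradient of \<open>l\<close> at \<open>T x0\<close>, optimality makes \<open>\<phi> x = P x - P x0 + w \<bullet> T (x - x0)\<close>
  nonnegative, so the excess \<open>\<theta>\<close> of the objective over its minimum \<open>a\<close> bounds both \<open>\<phi> x\<close> and a
  multiple of the squared constraint violation at \<open>T x\<close>. Points with \<open>\<phi> x \<le> 0\<close> and no violation are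
  minimizers, and together with a height \<open>t \<ge> P x\<close> they form a polyhedron. Hoffman's bound, applied
  to this polyhedron at the graph point \<open>(x, P x)\<close>, yields a minimizer \<open>x'\<close> at distance of order
  \<open>\<surd>\<theta>\<close> from \<open>x\<close>. The subgradient inequality between \<open>x\<close> and \<open>x'\<close> then reads
  \<open>\<theta> \<le> \<parallel>v\<parallel> O(\<surd>\<theta>)\<close>, which is the claim.\<close>
lemma slope_bound_at_minimizer:
  fixes T :: "'a::euclidean_space \<Rightarrow> 'b::euclidean_space"
  assumes T: "linear T" and growth: "polyhedral_growth_at l (T x0)" and P: "polyhedral_fun P"
    and l_inf: "\<And>y. l y \<noteq> -\<infinity>" and P_inf: "\<And>x. P x \<noteq> -\<infinity>"
    and x0: "l (T x0) + P x0 = ereal a" and minim: "\<And>z. ereal a \<le> l (T z) + P z"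
  shows "sqrt_slope_bound (\<lambda>x. l (T x) + P x) x0 a"
proof -
  obtain L0 p0 where L0: "l (T x0) = ereal L0" and p0: "P x0 = ereal p0" and a: "a = L0 + p0"
    using ereal_add_eq_realE[OF x0 l_inf P_inf] .
  obtain w C \<kappa> where C: "finite C" and \<kappa>: "\<kappa> > 0"
    and up: "\<forall>\<eta>>0. \<forall>\<^sub>F y in nhds (T x0). l y \<le> ereal (L0 + (w \<bullet> (y - T x0) + \<eta> * norm (y - T x0)))"
    and low: "\<forall>\<^sub>F y in nhds (T x0). ereal (L0 + (w \<bullet> (y - T x0) + \<kappa> * (violation C y)\<^sup>2)) \<le> l y"
    and flat: "\<forall>y\<in>halfspaces C. l y \<le> ereal (L0 + w \<bullet> (y - T x0))"
    using growth unfolding polyhedral_growth_at_def L0 plus_ereal.simps by blast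
  have Pconv: "convex_fun P"
    using P unfolding polyhedral_fun_def convex_fun_def by (rule polyhedron_imp_convex)
  \<comment> \<open>First-order optimality of \<open>x0\<close>: \<open>-T\<^sup>*w\<close> is a subgradient of \<open>P\<close> at \<open>x0\<close>.\<close>
  have opt: "0 \<le> p - p0 + w \<bullet> (T x - T x0)" if p: "P x = ereal p" for x p
  proof -
    define d where "d = T x - T x0"
    have "0 \<le> p - p0 + w \<bullet> d + e" if e: "e > 0" for e
    proof -
      define \<eta> where "\<eta> = e / (norm d + 1)"
      have "\<eta> > 0" unfolding \<eta>_def using e by (simp add: add_nonneg_pos)
      moreover have "((\<lambda>t. T x0 + t *\<^sub>R d) \<longlongrightarrow> T x0 + 0 *\<^sub>R d) (at_right (0::real))"
        by (intro tendsto_intros)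
      ultimately have "\<forall>\<^sub>F t in at_right 0. l (T x0 + t *\<^sub>R d) \<le> ereal (L0 + (w \<bullet> (T x0 + t *\<^sub>R d - T x0) + \<eta> * norm (T x0 + t *\<^sub>R d - T x0)))"
        using up unfolding filterlim_iff scaleR_zero_left add_0_right by blast
      moreover have "\<forall>\<^sub>F t in at_right (0::real). 0 < t \<and> t < 1"
        by (auto simp: eventually_at_right_field intro!: exI[of _ 1])
      ultimately have "\<forall>\<^sub>F t in at_right 0. 0 < t \<and> t < 1 \<and> l (T x0 + t *\<^sub>R d) \<le> ereal (L0 + (t * (w \<bullet> d) + \<eta> * (t * norm d)))"
        by eventually_elim auto
      from eventually_happens'[OF _ this] obtain t :: real where t: "0 < t" "t < 1"
        and lt: "l (T x0 + t *\<^sub>R d) \<le> ereal (L0 + (t * (w \<bullet> d) + \<eta> * (t * norm d)))" by auto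
      have "T ((1 - t) *\<^sub>R x0 + t *\<^sub>R x) = T x0 + t *\<^sub>R d"
        unfolding d_def linear_add[OF T] linear_scale[OF T] by (simp add: algebra_simps)
      then have "ereal a \<le> l (T x0 + t *\<^sub>R d) + P ((1 - t) *\<^sub>R x0 + t *\<^sub>R x)"
        using minim[of "(1 - t) *\<^sub>R x0 + t *\<^sub>R x"] by simp
      also have "\<dots> \<le> ereal (L0 + (t * (w \<bullet> d) + \<eta> * (t * norm d))) + ereal ((1 - t) * p0 + t * p)"
        using lt convex_funD[OF Pconv, of x0 p0 x p t] p0 p t by (intro add_mono) auto
      finally have "0 \<le> t * (p - p0 + w \<bullet> d + \<eta> * norm d)"
        unfolding a by (simp add: algebra_simps)
      then have "0 \<le> p - p0 + w \<bullet> d + \<eta> * norm d" using t by (simp add: zero_le_mult_iff)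
      moreover have "\<eta> * norm d \<le> e"
        unfolding \<eta>_def using e by (simp add: divide_simps add_nonneg_pos mult_left_mono)
      ultimately show ?thesis by linarith
    qed
    then show ?thesis unfolding d_def by (rule field_le_epsilon)
  qed
  obtain F where F: "finite F" "eepigraph P = halfspaces F"
    using P unfolding polyhedral_fun_def by (rule polyhedron_as_halfspaces)
  \<comment> \<open>The constraints of the epigraph, those on \<open>T x\<close> pulled back, and \<open>\<phi> x \<le> 0\<close> with \<open>t\<close> for \<open>P x\<close>.\<close>
  define C' where "C' = F \<union> (\<lambda>c. ((adjoint T (fst c), 0), snd c)) ` C \<union> {((adjoint T w, 1), p0 + w \<bullet> T x0)}"
  have C': "finite C'" unfolding C'_def using F(1) C by simp
  have adj: "adjoint T y \<bullet> x = y \<bullet> T x" for x y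
    by (metis T adjoint_works inner_commute)
  have mem: "(x, t) \<in> halfspaces C' \<longleftrightarrow> P x \<le> ereal t \<and> T x \<in> halfspaces C \<and> t \<le> p0 - w \<bullet> (T x - T x0)" for x t
  proof -
    have "(x, t) \<in> halfspaces C' \<longleftrightarrow> (x, t) \<in> halfspaces F \<and> T x \<in> halfspaces C \<and> t \<le> p0 - w \<bullet> (T x - T x0)"
      unfolding C'_def halfspaces_def by (auto simp: ball_Un adj inner_diff_right)
    then show ?thesis unfolding F(2)[symmetric] eepigraph_def by simp
  qed
  have "T x0 \<in> halfspaces C"
  proof (rule violation_eq_0_imp[OF C])
    have "\<kappa> * (violation C (T x0))\<^sup>2 \<le> 0"
      using eventually_nhds_x_imp_x[OF low] unfolding L0 by simp
    then show "violation C (T x0) = 0" using \<kappa> by (simp add: mult_le_0_iff)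
  qed
  then have "(x0, p0) \<in> halfspaces C'" unfolding mem using p0 by simp
  then obtain K where K: "K > 0" "\<And>z. \<exists>q\<in>halfspaces C'. norm (z - q) \<le> K * violation C' z"
    using Hoffman_error_bound[OF C'] by blast
  have "(T \<longlongrightarrow> T x0) (nhds x0)"
    by (rule linear_tendsto_nhds[OF T])
  then have "\<forall>\<^sub>F x in nhds x0. ereal (L0 + (w \<bullet> (T x - T x0) + \<kappa> * (violation C (T x))\<^sup>2)) \<le> l (T x)"
    using low unfolding filterlim_iff by blast
  then obtain \<epsilon> where \<epsilon>: "\<epsilon> > 0" and lowx: "\<And>x. norm (x - x0) < \<epsilon> \<Longrightarrow>
      ereal (L0 + (w \<bullet> (T x - T x0) + \<kappa> * (violation C (T x))\<^sup>2)) \<le> l (T x)"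
    unfolding eventually_nhds_metric dist_norm by blast
  define M where "M = max 1 (1 / sqrt \<kappa>)"
  define N where "N = K * (real (card C') + 1) * M"
  have M: "1 \<le> M" "1 / sqrt \<kappa> \<le> M" unfolding M_def by auto
  have N: "N > 0" unfolding N_def using K(1) M(1) by (simp add: add_nonneg_pos)
  have "1 / N * sqrt (p - a) \<le> norm v"
    if x: "norm (x - x0) < \<epsilon>" and gx: "l (T x) + P x = ereal p" and p: "a < p" "p < a + 1"
      and v: "convex_subgradient (\<lambda>x. l (T x) + P x) x v" for x v p
  proof -
    define \<theta> where "\<theta> = p - a"
    have \<theta>: "0 < \<theta>" "\<theta> < 1" unfolding \<theta>_def using p by auto
    obtain L1 p1 where L1: "l (T x) = ereal L1" and p1: "P x = ereal p1" and p_eq: "p = L1 + p1"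
      using ereal_add_eq_realE[OF gx l_inf P_inf] .
    define \<phi> where "\<phi> = p1 - p0 + w \<bullet> (T x - T x0)"
    have \<phi>0: "0 \<le> \<phi>" unfolding \<phi>_def by (rule opt[OF p1])
    have "\<phi> + \<kappa> * (violation C (T x))\<^sup>2 \<le> \<theta>"
      using lowx[OF x] unfolding L1 \<phi>_def \<theta>_def p_eq a by simp
    moreover have "0 \<le> \<kappa> * (violation C (T x))\<^sup>2" using \<kappa> by simp
    ultimately have \<phi>1: "\<phi> \<le> \<theta>" and "\<kappa> * (violation C (T x))\<^sup>2 \<le> \<theta>" using \<phi>0 by linarith+
    then have "(violation C (T x))\<^sup>2 \<le> \<theta> / \<kappa>" using \<kappa> by (simp add: field_simps)
    then have "violation C (T x) \<le> 1 / sqrt \<kappa> * sqrt \<theta>"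
      using real_le_rsqrt by (fastforce simp: real_sqrt_divide)
    then have vC: "violation C (T x) \<le> M * sqrt \<theta>"
      using mult_right_mono[OF M(2), of "sqrt \<theta>"] \<theta>(1) by simp
    \<comment> \<open>Here \<open>\<theta> < 1\<close> is essential: the constraint \<open>\<phi> x \<le> 0\<close> is violated linearly in \<open>\<theta>\<close>.\<close>
    have "\<theta> \<le> sqrt \<theta>"
      using \<theta> by (intro real_le_rsqrt) (simp add: power2_eq_square mult_left_le)
    also have "\<dots> \<le> M * sqrt \<theta>" using mult_right_mono[OF M(1), of "sqrt \<theta>"] \<theta>(1) by simp
    finally have \<phi>M: "\<phi> \<le> M * sqrt \<theta>" using \<phi>1 by simp
    have M0: "0 \<le> M * sqrt \<theta>" using M(1) \<theta>(1) by simp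
    have "fst c \<bullet> (x, p1) - snd c \<le> M * sqrt \<theta>" if c: "c \<in> C'" for c
    proof -
      consider "c \<in> F" | b where "b \<in> C" "c = ((adjoint T (fst b), 0), snd b)"
        | "c = ((adjoint T w, 1), p0 + w \<bullet> T x0)"
        using c unfolding C'_def by blast
      then show ?thesis
      proof cases
        case 1
        have "(x, p1) \<in> halfspaces F" unfolding F(2)[symmetric] eepigraph_def using p1 by simp
        then show ?thesis using 1 M0 unfolding halfspaces_def by fastforce
      next
        case 2
        then show ?thesis using violation_ge_member[OF C 2(1), of "T x"] vC by (simp add: adj)
      next
        case 3
        then show ?thesis using \<phi>M unfolding \<phi>_def by (simp add: adj inner_diff_right)
      qed
    qed
    then have "violation C' (x, p1) \<le> real (card C') * (M * sqrt \<theta>)"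
      using M0 by (rule violation_le)
    also have "\<dots> \<le> (real (card C') + 1) * (M * sqrt \<theta>)" using M0 by (rule mult_right_mono[rotated]) simp
    finally have "K * violation C' (x, p1) \<le> N * sqrt \<theta>"
      unfolding N_def using K(1) by (simp add: mult.assoc)
    moreover obtain q where q: "q \<in> halfspaces C'" "norm ((x, p1) - q) \<le> K * violation C' (x, p1)"
      using K(2) by blast
    moreover obtain x' t where q_eq: "q = (x', t)" by (cases q)
    ultimately have xx': "norm (x - x') \<le> N * sqrt \<theta>"
      using norm_fst_le[of "x - x'" "p1 - t"] by simp
    \<comment> \<open>The nearby feasible point \<open>x'\<close> is a minimizer.\<close>
    have "l (T x') + P x' \<le> ereal (L0 + w \<bullet> (T x' - T x0)) + ereal t"
      using q(1) flat unfolding q_eq mem by (intro add_mono) auto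
    also have "\<dots> \<le> ereal a"
      using q(1) unfolding q_eq mem a by simp
    finally have "l (T x') + P x' \<le> ereal a" .
    moreover have "ereal p + ereal (v \<bullet> (x' - x)) \<le> l (T x') + P x'"
      using v gx unfolding convex_subgradient_def by metis
    ultimately have "ereal (p + v \<bullet> (x' - x)) \<le> ereal a" by (metis order_trans plus_ereal.simps(1))
    then have "\<theta> \<le> v \<bullet> (x - x')" unfolding \<theta>_def by (simp add: inner_diff_right)
    also have "\<dots> \<le> norm v * norm (x - x')" by (rule norm_cauchy_schwarz)
    also have "\<dots> \<le> norm v * (N * sqrt \<theta>)" using xx' by (rule mult_left_mono) simp
    finally have "sqrt \<theta> * sqrt \<theta> \<le> (norm v * N) * sqrt \<theta>" using \<theta>(1) by simp
    then have "sqrt \<theta> \<le> norm v * N" by (rule mult_right_le_imp_le) (use \<theta>(1) in simp)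
    then show ?thesis unfolding \<theta>_def using N by (simp add: divide_simps mult.commute)
  qed
  then show ?thesis unfolding sqrt_slope_bound_def
    using N \<epsilon> by (intro exI[of _ "1 / N"] exI[of _ \<epsilon>] exI[of _ 1]) auto
qed

text \<open>Lower semicontinuity keeps a piece whose value at \<open>x0\<close> exceeds \<open>a\<close> above \<open>a + \<delta>\<close> near \<open>x0\<close>, so no
  point qualifies once \<open>\<nu> = \<delta>\<close>. For \<open>P\<close> this is closedness; \<open>l\<close> is controlled by the affine lower
  bound contained in the growth condition.\<close>
lemma slope_bound_above_level:
  fixes T :: "'a::euclidean_space \<Rightarrow> 'b::euclidean_space"
  assumes T: "linear T" and growth: "polyhedral_growth_at l (T x0)" and P: "closed_fun P"
    and L0: "l (T x0) = ereal L0" and above: "ereal a < l (T x0) + P x0"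
  shows "sqrt_slope_bound (\<lambda>x. l (T x) + P x) x0 a"
proof -
  obtain w C \<kappa> where \<kappa>: "\<kappa> > (0::real)"
    and low: "\<forall>\<^sub>F y in nhds (T x0). ereal (L0 + (w \<bullet> (y - T x0) + \<kappa> * (violation C y)\<^sup>2)) \<le> l y"
    using growth unfolding polyhedral_growth_at_def L0 plus_ereal.simps by blast
  have "ereal (a - L0) < P x0" using above unfolding L0 by (cases "P x0") auto
  then obtain e where e: "ereal (a - L0) < e" "e < P x0" using dense by blast
  then obtain b where b: "e = ereal b" by (cases e) auto
  define \<delta> where "\<delta> = (b - (a - L0)) / 2"
  have \<delta>: "\<delta> > 0" unfolding \<delta>_def using e(1) b by simp
  have "P x0 \<le> Liminf (at x0) P" using P unfolding closed_fun_def by blast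
  then have "\<forall>\<^sub>F x in at x0. ereal b < P x" unfolding le_Liminf_iff using e(2) b by blast
  then have Pnear: "\<forall>\<^sub>F x in nhds x0. ereal b < P x"
    unfolding eventually_nhds_conv_at using e(2) b by simp
  have Tlim: "(T \<longlongrightarrow> T x0) (nhds x0)"
    by (rule linear_tendsto_nhds[OF T])
  then have lnear: "\<forall>\<^sub>F x in nhds x0. ereal (L0 + (w \<bullet> (T x - T x0) + \<kappa> * (violation C (T x))\<^sup>2)) \<le> l (T x)"
    using low unfolding filterlim_iff by blast
  have "((\<lambda>x. w \<bullet> (T x - T x0)) \<longlongrightarrow> w \<bullet> (T x0 - T x0)) (nhds x0)"
    by (intro tendsto_intros Tlim)
  then have "\<forall>\<^sub>F x in nhds x0. - \<delta> < w \<bullet> (T x - T x0)"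
    using \<delta> by (intro order_tendstoD(1)) auto
  with Pnear lnear have "\<forall>\<^sub>F x in nhds x0. ereal (a + \<delta>) \<le> l (T x) + P x"
  proof eventually_elim
    case (elim x)
    have "0 \<le> \<kappa> * (violation C (T x))\<^sup>2" using \<kappa> by simp
    then have "a + \<delta> \<le> L0 + (w \<bullet> (T x - T x0) + \<kappa> * (violation C (T x))\<^sup>2) + b"
      using elim(3) unfolding \<delta>_def by (simp add: field_simps)
    then have "ereal (a + \<delta>) \<le> ereal (L0 + (w \<bullet> (T x - T x0) + \<kappa> * (violation C (T x))\<^sup>2)) + ereal b"
      by simp
    also have "\<dots> \<le> l (T x) + P x" using elim by (intro add_mono) auto
    finally show ?case .
  qed
  then obtain \<epsilon> where "\<epsilon> > 0" "\<And>x. norm (x - x0) < \<epsilon> \<Longrightarrow> ereal (a + \<delta>) \<le> l (T x) + P x"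
    unfolding eventually_nhds_metric dist_norm by blast
  then show ?thesis unfolding sqrt_slope_bound_def
    using \<delta> by (intro exI[of _ 1] exI[of _ \<epsilon>] exI[of _ \<delta>]) force
qed

section \<open>From the pieces to their minimum\<close>

text \<open>The bound holds first for regular subgradients, each of which is a convex subgradient of an active
  piece. It passes to limiting subgradients because \<open>f\<close> converges along the defining sequences. Halving
  the radius keeps the approximating points within reach of the first bound.\<close>
lemma slope_bound_min_transfer:
  fixes f :: "'a::euclidean_space \<Rightarrow> ereal"
  assumes I: "finite I"
    and slope: "\<And>i. i \<in> I \<Longrightarrow> sqrt_slope_bound (g i) x0 a"
    and conv: "\<And>i. i \<in> I \<Longrightarrow> convex_fun (g i)"
    and le: "\<And>i x. i \<in> I \<Longrightarrow> f x \<le> g i x"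
    and att: "\<And>x. \<exists>i\<in>I. f x = g i x"
    and x0: "x0 \<in> dom_subdiff f" and fx0: "f x0 = ereal a"
  shows "KL_property_at f x0 (1/2)"
proof -
  from slope have "\<forall>i\<in>I. \<exists>c \<epsilon> \<nu>. 0 < c \<and> 0 < \<epsilon> \<and> 0 < \<nu> \<and>
     (\<forall>x v p. norm (x - x0) < \<epsilon> \<longrightarrow> g i x = ereal p \<longrightarrow> a < p \<longrightarrow> p < a + \<nu> \<longrightarrow>
        convex_subgradient (g i) x v \<longrightarrow> c * sqrt (p - a) \<le> norm v)"
    unfolding sqrt_slope_bound_def by blast
  then obtain c \<epsilon> \<nu> where pos: "\<And>i. i \<in> I \<Longrightarrow> 0 < c i \<and> 0 < \<epsilon> i \<and> 0 < \<nu> i"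
    and bound: "\<And>i x v p. i \<in> I \<Longrightarrow> norm (x - x0) < \<epsilon> i \<Longrightarrow> g i x = ereal p \<Longrightarrow> a < p \<Longrightarrow> p < a + \<nu> i \<Longrightarrow>
        convex_subgradient (g i) x v \<Longrightarrow> c i * sqrt (p - a) \<le> norm v"
    unfolding bchoice_iff by blast
  have I0: "I \<noteq> {}" using att by blast
  define c0 \<epsilon>0 \<nu>0 where "c0 = Min (c ` I)" and "\<epsilon>0 = Min (\<epsilon> ` I)" and "\<nu>0 = Min (\<nu> ` I)"
  have pos0: "0 < c0" "0 < \<epsilon>0" "0 < \<nu>0"
    unfolding c0_def \<epsilon>0_def \<nu>0_def using I I0 pos by (simp_all add: Min_gr_iff)
  have le0: "c0 \<le> c i" "\<epsilon>0 \<le> \<epsilon> i" "\<nu>0 \<le> \<nu> i" if "i \<in> I" for i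
    unfolding c0_def \<epsilon>0_def \<nu>0_def using I that by simp_all
  have regular: "c0 * sqrt (p - a) \<le> norm v"
    if x: "norm (x - x0) < \<epsilon>0" and p: "f x = ereal p" "a < p" "p < a + \<nu>0"
      and v: "v \<in> regular_subdiff f x" for x v p
  proof -
    obtain i where i: "i \<in> I" "f x = g i x" using att by blast
    have "convex_subgradient (g i) x v"
      by (rule regular_subgradient_of_touching_minorant[OF conv[OF i(1)] _ i(2) le[OF i(1)] v])
        (use p i in simp)
    then have "c i * sqrt (p - a) \<le> norm v"
      using bound[OF i(1), of x p v] x p i le0[OF i(1)] by auto
    moreover have "c0 * sqrt (p - a) \<le> c i * sqrt (p - a)"
      using le0[OF i(1)] p(2) by (intro mult_right_mono) auto
    ultimately show ?thesis by linarith
  qed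
  have "ereal (c0 * real_of_ereal (f x - f x0) powr (1/2)) \<le> edist_set 0 (subdiff f x)"
    if near: "norm (x - x0) \<le> \<epsilon>0 / 2" and range: "f x0 < f x" "f x < f x0 + ereal \<nu>0" for x
  proof -
    obtain p where p: "f x = ereal p" "a < p" "p < a + \<nu>0"
      using range unfolding fx0 by (cases "f x") auto
    have "c0 * sqrt (p - a) \<le> norm v" if v: "v \<in> subdiff f x" for v
    proof -
      obtain X V where X: "X \<longlonglongrightarrow> x" and fX: "(\<lambda>t. f (X t)) \<longlonglongrightarrow> f x" and V: "V \<longlonglongrightarrow> v"
        and reg: "\<And>t::nat. V t \<in> regular_subdiff f (X t)"
        using v unfolding subdiff_def by (auto split: if_splits)
      have "\<forall>\<^sub>F t in sequentially. norm (X t - x0) < \<epsilon>0"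
      proof (rule order_tendstoD(2))
        show "(\<lambda>t. norm (X t - x0)) \<longlonglongrightarrow> norm (x - x0)" by (intro tendsto_intros X)
        show "norm (x - x0) < \<epsilon>0" using near pos0 by simp
      qed
      moreover have "\<forall>\<^sub>F t in sequentially. ereal a < f (X t)" "\<forall>\<^sub>F t in sequentially. f (X t) < ereal (a + \<nu>0)"
        using order_tendstoD[OF fX] p by auto
      ultimately have "\<forall>\<^sub>F t in sequentially. c0 * sqrt (real_of_ereal (f (X t)) - a) \<le> norm (V t)"
      proof eventually_elim
        case (elim t)
        then obtain pt where "f (X t) = ereal pt" by (cases "f (X t)") auto
        then show ?case using regular[OF elim(1) _ _ _ reg] elim by auto
      qed
      moreover have "(\<lambda>t. real_of_ereal (f (X t))) \<longlonglongrightarrow> p"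
        using lim_real_of_ereal fX unfolding p(1) by blast
      then have "(\<lambda>t. c0 * sqrt (real_of_ereal (f (X t)) - a)) \<longlonglongrightarrow> c0 * sqrt (p - a)"
        by (intro tendsto_mult tendsto_const tendsto_real_sqrt tendsto_diff)
      ultimately show ?thesis
        by (intro tendsto_le[OF sequentially_bot tendsto_norm[OF V]])
    qed
    then show ?thesis
      unfolding edist_set_def p(1) fx0 using p(2) by (auto intro!: INF_greatest simp: powr_half_sqrt)
  qed
  then show ?thesis
    unfolding KL_property_at_def using x0 pos0
    by (intro conjI exI[of _ c0] exI[of _ "\<epsilon>0 / 2"] exI[of _ "ereal \<nu>0"]) auto
qed

theorem corollary5p1:
  fixes f :: "real ^ 'n \<Rightarrow> ereal"
    and l :: "real ^ 'm \<Rightarrow> ereal"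
    and A :: "real ^ 'n ^ 'm"
    and P :: "nat \<Rightarrow> real ^ 'n \<Rightarrow> ereal"
    and r :: nat
  assumes f_proper: "proper_fun f"
    and f_closed: "closed_fun f"
    and r_pos: "1 \<le> r"
    and f_form: "\<And>x. f x = l (A *v x) + (MIN i\<in>{1..r}. P i x)"
    and P_polyhedral:
      "\<And>i. i \<in> {1..r} \<Longrightarrow> proper_fun (P i) \<and> closed_fun (P i) \<and> polyhedral_fun (P i)"
    and l_cond: "smooth_loss l \<or> max_loss l"
    and f_cont: "continuous_on (dom_subdiff f) f"
  shows "KL_function f (1/2)"
proof -
  let ?T = "\<lambda>x. A *v x"
  define g where "g i x = l (A *v x) + P i x" for i x
  have T: "linear ?T" by (rule matrix_vector_mul_linear)
  have fin: "finite {1..r}" "{1..r} \<noteq> {}" using r_pos by auto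
  have le: "f x \<le> g i x" if "i \<in> {1..r}" for i x
    unfolding f_form g_def using fin that by (intro add_left_mono Min_le) auto
  have att: "\<exists>i\<in>{1..r}. f x = g i x" for x
  proof -
    have "(MIN i\<in>{1..r}. P i x) \<in> (\<lambda>i. P i x) ` {1..r}" using fin by (intro Min_in) auto
    then show ?thesis unfolding f_form g_def by auto
  qed
  have l_inf: "l y \<noteq> -\<infinity>" for y
    using l_cond
  proof
    assume "max_loss l"
    then show ?thesis unfolding max_loss_def by (metis MInfty_neq_ereal(1))
  qed (auto simp: smooth_loss_def proper_fun_def)
  have l_conv: "convex_fun l"
    using l_cond max_loss_convex by (auto simp: smooth_loss_def)
  have growth: "polyhedral_growth_at l y" if "y \<in> edom l" for y
    using l_cond smooth_loss_polyhedral_growth[OF _ that] max_loss_polyhedral_growth by blast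
  have P_inf: "P i x \<noteq> -\<infinity>" if "i \<in> {1..r}" for i x
    using P_polyhedral[OF that] unfolding proper_fun_def by blast
  have P_conv: "convex_fun (P i)" if "i \<in> {1..r}" for i
    using P_polyhedral[OF that] polyhedron_imp_convex unfolding polyhedral_fun_def convex_fun_def by blast
  have conv: "convex_fun (g i)" if "i \<in> {1..r}" for i
    unfolding g_def using convex_fun_compose_linear_add[OF l_conv P_conv[OF that] T l_inf P_inf[OF that]] .
  have "KL_property_at f x0 (1/2)" if x0: "x0 \<in> dom_subdiff f" for x0
  proof -
    have "f x0 < \<infinity>" using x0 unfolding dom_subdiff_def subdiff_def edom_def by (auto split: if_splits)
    moreover have "f x0 \<noteq> -\<infinity>" using f_proper unfolding proper_fun_def by blast
    ultimately obtain a where a: "f x0 = ereal a" by (cases "f x0") auto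
    obtain j where j: "j \<in> {1..r}" "l (A *v x0) + P j x0 = ereal a"
      using att[of x0] a unfolding g_def by auto
    obtain L0 where L0: "l (A *v x0) = ereal L0"
      using ereal_add_eq_realE[OF j(2) l_inf P_inf[OF j(1)]] by metis
    then have gr: "polyhedral_growth_at l (A *v x0)" by (intro growth) (simp add: edom_def)
    have "sqrt_slope_bound (g i) x0 a" if i: "i \<in> {1..r}" for i
    proof (cases "g i x0 = ereal a")
      case False
      then have "ereal a < g i x0" using le[OF i, of x0] a by (simp add: less_le)
      then show ?thesis
        unfolding g_def using P_polyhedral[OF i] by (intro slope_bound_above_level[OF T gr _ L0]) auto
    next
      case True
      show ?thesis
      proof (cases "\<forall>z. ereal a \<le> g i z")
        case minim: True
        show ?thesis
          using True minim P_polyhedral[OF i] unfolding g_def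
          by (intro slope_bound_at_minimizer[OF T gr _ l_inf P_inf[OF i]]) auto
      next
        case False
        then obtain z where z: "g i z < ereal a" by (auto simp: not_le)
        moreover have "g i z \<noteq> -\<infinity>" unfolding g_def using l_inf P_inf[OF i] by simp
        ultimately obtain b where "g i z = ereal b" by (cases "g i z") auto
        then show ?thesis using z by (intro slope_bound_at_nonminimizer[of b _ z]) auto
      qed
    qed
    then show ?thesis using slope_bound_min_transfer[OF fin(1) _ conv le att x0 a] by blast
  qed
  then show ?thesis unfolding KL_function_def using f_proper f_closed by blast
qed

end
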